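(* Let $(E,w)$ be an acyclic (LPA) weighted graph, $(E',w')$ its $\mathcal P1$-weighted graph, and $\widetilde{E'}$ the auxiliary graph of $(E',w')$. Then the weighted graph monoid $\mathcal M(E,w)$ is cancellative if and only if no cycle in $\widetilde{E'}$ contains a bar edge.
   Context: A directed graph is $E=(E^0,E^1,s,r)$. Paths are sequences of edges $e_1\cdots e_n$ with $r(e_i)=s(e_{i+1})$; vertices are paths of length $0$. $u\ge v$ means there is a path from $u$ to $v$; $T(u)=\{x:u\ge x\}$, $T(X)=\bigcup_{v\in X}T(v)$. A cycle based at $s(e_1)$ is a path $e_1\cdots e_n$, $n\ge1$, with $s(e_1)=r(e_n)$ and the $s(e_i)$ pairwise distinct; a graph is acyclic if it has no cycles, and a weighted graph is acyclic if its underlying graph is. Edges $e,f$ are in line if $e=f$, $r(e)\ge s(f)$ or $r(f)\ge s(e)$. A weighted graph $(E,w)$ is a directed graph with $w:E^1\to\{1,2,\dots\}$; standing assumption: nonempty, row-finite ($|s^{-1}(v)|<\infty$ for all $v$), connected. $E_w=\{e:w(e)>1\}$ (weighted edges), $E_{uw}=\{e:w(e)=1\}$ (unweighted edges). Condition (LPA): (LPA1) every vertex emits at most one weighted edge; (LPA2) every vertex in $T(r(E_w))$ emits at most one edge; (LPA3) if $e,f\in E_w$ are not in line then $T(r(e))\cap T(r(f))=\varnothing$; (LPA4) if $e\in E_w$ and $C$ is a cycle based at some $v\in T(r(e))$, then $e$ is an edge of $C$. An (LPA) weighted graph is one satisfying these. $\mathcal P1$-weighted graph $(E',w')$ of an (LPA)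 weighted graph $(E,w)$: with $Z=T(r(E_w))$, $(E')^0=E^0$; each edge $e$ with $s(e)\in Z$ is replaced by $w(e)$ edges $e^{(1)},\dots,e^{(w(e))}$ of weight $1$ from $r(e)$ to $s(e)$; edges $e$ with $s(e)\notin Z$ are kept with the same source, range and weight. Auxiliary graph $\widetilde G$ of a weighted graph $(G,w)$: the directed graph with vertex set $G^0$ whose edges are the unweighted edges $e\in G_{uw}$ (same source and range as in $G$) together with, for each weighted edge $g\in G_w$, a bar edge $\overline g$ with source $r(g)$ and range $s(g)$. The weighted graph monoid $\mathcal M(E,w)$ is the commutative monoid generated by $\{v,q_1^v,\dots,q_{k_v-1}^v:v\in E^0\}$ with relations $q_{i-1}^v+(w_i(v)-w_{i-1}(v))v=q_i^v+\sum_{e\in s^{-1}(v),\,w(e)=w_i(v)}r(e)$ for $v\in E^0$, $1\le i\le k_v$, where $w_1(v)<\dots<w_{k_v}(v)$ are the distinct weights of the edges in $s^{-1}(v)$ and $q_0^v=q_{k_v}^v=0$, $w_0(v)=0$. A commutative monoid is cancellative if $a+b=c+b$ implies $a=c$. *)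

theory Defs
  imports "Graph_Theory.Graph_Theory" "HOL-Algebra.Divisibility"
begin

section \<open>Weighted graphs\<close>

definition acyclic_digraph :: "('v, 'e) pre_digraph \<Rightarrow> bool" where
  "acyclic_digraph G \<longleftrightarrow> \<not> (\<exists>p. pre_digraph.cycle G p)"

text \<open>The library's cycles are not based. Since \<^const>\<open>pre_digraph.cycle\<close> asks for the ranges of
  the edges of a nonempty closed walk to be distinct, its sources, which are the same vertices up to
  a cyclic shift, are distinct as well.\<close>

definition cycle_based_at :: "('v, 'e) pre_digraph \<Rightarrow> 'v \<Rightarrow> 'e list \<Rightarrow> bool" where
  "cycle_based_at G v p \<longleftrightarrow> pre_digraph.cycle G p \<and> tail G (hd p) = v"

lemma cycle_iff_tails:
  "pre_digraph.cycle G p \<longleftrightarrow>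
     p \<noteq> [] \<and> pre_digraph.awalk G (tail G (hd p)) p (tail G (hd p)) \<and> distinct (map (tail G) p)"
proof -
  have len: "pre_digraph.awalk_verts G u p = map (tail G) p @ [v]"
    if "pre_digraph.cas G u p v" "p \<noteq> []" for u v
    using that
  proof (induction p arbitrary: u)
    case (Cons e p)
    then show ?case
      by (cases p) (auto simp: pre_digraph.cas.simps pre_digraph.awalk_verts.simps)
  qed simp
  have hd: "tail G (hd p) = u" if "pre_digraph.cas G u p v" "p \<noteq> []" for u v
    using that by (cases p) (auto simp: pre_digraph.cas.simps)
  have dist: "distinct (tl (map (tail G) p @ [tail G (hd p)])) \<longleftrightarrow> distinct (map (tail G) p)"
    if "p \<noteq> []"
    using that by (cases p) auto
  show ?thesis
  proof
    assume "pre_digraph.cycle G p"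
    then obtain u where u: "pre_digraph.awalk G u p u" "p \<noteq> []"
      "distinct (tl (pre_digraph.awalk_verts G u p))"
      by (auto simp: pre_digraph.cycle_def)
    then have c: "pre_digraph.cas G u p u" by (simp add: pre_digraph.awalk_def)
    show "p \<noteq> [] \<and> pre_digraph.awalk G (tail G (hd p)) p (tail G (hd p)) \<and> distinct (map (tail G) p)"
      using u hd[OF c u(2)] dist[OF u(2)] by (simp add: len[OF c u(2)])
  next
    assume a: "p \<noteq> [] \<and> pre_digraph.awalk G (tail G (hd p)) p (tail G (hd p)) \<and> distinct (map (tail G) p)"
    then have c: "pre_digraph.cas G (tail G (hd p)) p (tail G (hd p))"
      by (simp add: pre_digraph.awalk_def)
    have "distinct (tl (pre_digraph.awalk_verts G (tail G (hd p)) p))"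
      using a dist by (simp add: len[OF c])
    then show "pre_digraph.cycle G p"
      using a by (auto simp: pre_digraph.cycle_def)
  qed
qed

definition tree_from :: "('v, 'e) pre_digraph \<Rightarrow> 'v \<Rightarrow> 'v set" where
  "tree_from G u = {x. reachable G u x}"

definition tree_from_set :: "('v, 'e) pre_digraph \<Rightarrow> 'v set \<Rightarrow> 'v set" where
  "tree_from_set G X = (\<Union>v\<in>X. tree_from G v)"

definition in_line :: "('v, 'e) pre_digraph \<Rightarrow> 'e \<Rightarrow> 'e \<Rightarrow> bool" where
  "in_line G e f \<longleftrightarrow> e = f \<or> reachable G (head G e) (tail G f) \<or> reachable G (head G f) (tail G e)"

definition weighted_arcs :: "('v, 'e) pre_digraph \<Rightarrow> ('e \<Rightarrow> nat) \<Rightarrow> 'e set" where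
  "weighted_arcs G w = {e \<in> arcs G. w e > 1}"

definition unweighted_arcs :: "('v, 'e) pre_digraph \<Rightarrow> ('e \<Rightarrow> nat) \<Rightarrow> 'e set" where
  "unweighted_arcs G w = {e \<in> arcs G. w e = 1}"

text \<open>The set \<open>Z = T(r(E\<^sub>w))\<close>.\<close>

definition weighted_tree :: "('v, 'e) pre_digraph \<Rightarrow> ('e \<Rightarrow> nat) \<Rightarrow> 'v set" where
  "weighted_tree G w = tree_from_set G (head G ` weighted_arcs G w)"

locale weighted_graph = wf_digraph G
  for G :: "('v, 'e) pre_digraph" and w :: "'e \<Rightarrow> nat" +
  assumes weight_pos: "e \<in> arcs G \<Longrightarrow> w e \<ge> 1"
    and nonempty: "verts G \<noteq> {}"
    and row_finite: "v \<in> verts G \<Longrightarrow> finite (out_arcs G v)"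
    and graph_connected: "connected G"

locale lpa_weighted_graph = weighted_graph G w
  for G :: "('v, 'e) pre_digraph" and w :: "'e \<Rightarrow> nat" +
  assumes LPA1: "\<lbrakk>e \<in> weighted_arcs G w; f \<in> weighted_arcs G w; tail G e = tail G f\<rbrakk> \<Longrightarrow> e = f"
    and LPA2: "\<lbrakk>v \<in> weighted_tree G w; e \<in> out_arcs G v; f \<in> out_arcs G v\<rbrakk> \<Longrightarrow> e = f"
    and LPA3: "\<lbrakk>e \<in> weighted_arcs G w; f \<in> weighted_arcs G w; \<not> in_line G e f\<rbrakk>
                 \<Longrightarrow> tree_from G (head G e) \<inter> tree_from G (head G f) = {}"
    and LPA4: "\<lbrakk>e \<in> weighted_arcs G w; v \<in> tree_from G (head G e); cycle_based_at G v p\<rbrakk>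
                 \<Longrightarrow> e \<in> set p"


section \<open>The P1-weighted graph and the auxiliary graph\<close>

text \<open>\<open>Rev e i\<close> is the edge \<open>e\<^sup>(\<^sup>i\<^sup>)\<close> from \<open>r(e)\<close> to \<open>s(e)\<close>.\<close>

datatype 'e p1_arc = Kept 'e | Rev 'e nat

fun p1_weight :: "('e \<Rightarrow> nat) \<Rightarrow> 'e p1_arc \<Rightarrow> nat" where
  "p1_weight w (Kept e) = w e"
| "p1_weight w (Rev e i) = 1"

definition p1_graph :: "('v, 'e) pre_digraph \<Rightarrow> ('e \<Rightarrow> nat) \<Rightarrow> ('v, 'e p1_arc) pre_digraph" where
  "p1_graph G w =
     \<lparr>verts = verts G,
      arcs = {Kept e | e. e \<in> arcs G \<and> tail G e \<notin> weighted_tree G w} \<union>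
             {Rev e i | e i. e \<in> arcs G \<and> tail G e \<in> weighted_tree G w \<and> 1 \<le> i \<and> i \<le> w e},
      tail = (\<lambda>x. case x of Kept e \<Rightarrow> tail G e | Rev e i \<Rightarrow> head G e),
      head = (\<lambda>x. case x of Kept e \<Rightarrow> head G e | Rev e i \<Rightarrow> tail G e)\<rparr>"

datatype 'e aux_arc = Plain 'e | Bar 'e

definition aux_graph :: "('v, 'e) pre_digraph \<Rightarrow> ('e \<Rightarrow> nat) \<Rightarrow> ('v, 'e aux_arc) pre_digraph" where
  "aux_graph G w =
     \<lparr>verts = verts G,
      arcs = Plain ` unweighted_arcs G w \<union> Bar ` weighted_arcs G w,
      tail = (\<lambda>x. case x of Plain e \<Rightarrow> tail G e | Bar g \<Rightarrow> head G g),
      head = (\<lambda>x. case x of Plain e \<Rightarrow> head G e | Bar g \<Rightarrow> tail G g)\<rparr>"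

lemma (in wf_digraph) wf_p1_graph: "wf_digraph (p1_graph G w)"
  by unfold_locales (auto simp: p1_graph_def)

lemma (in wf_digraph) wf_aux_graph: "wf_digraph (aux_graph G w)"
  by unfold_locales (auto simp: aux_graph_def weighted_arcs_def unweighted_arcs_def)


section \<open>Commutative monoids given by generators and relations\<close>

text \<open>The free commutative monoid on \<open>X\<close> consists of the finite multisets over \<open>X\<close>.\<close>

definition free_cm :: "'g set \<Rightarrow> 'g multiset set" where
  "free_cm X = {a. set_mset a \<subseteq> X}"

inductive_set presented_cong :: "'g set \<Rightarrow> ('g multiset \<times> 'g multiset) set \<Rightarrow> ('g multiset \<times> 'g multiset) set"
  for X :: "'g set" and R :: "('g multiset \<times> 'g multiset) set" where
  rel: "(a, b) \<in> R \<Longrightarrow> (a, b) \<in> presented_cong X R"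
| refl: "a \<in> free_cm X \<Longrightarrow> (a, a) \<in> presented_cong X R"
| sym: "(a, b) \<in> presented_cong X R \<Longrightarrow> (b, a) \<in> presented_cong X R"
| trans: "\<lbrakk>(a, b) \<in> presented_cong X R; (b, c) \<in> presented_cong X R\<rbrakk> \<Longrightarrow> (a, c) \<in> presented_cong X R"
| add: "\<lbrakk>(a, b) \<in> presented_cong X R; c \<in> free_cm X\<rbrakk> \<Longrightarrow> (a + c, b + c) \<in> presented_cong X R"

definition presented_monoid :: "'g set \<Rightarrow> ('g multiset \<times> 'g multiset) set \<Rightarrow> 'g multiset set monoid" where
  "presented_monoid X R =
     \<lparr>carrier = free_cm X // presented_cong X R,
      mult = (\<lambda>A B. \<Union>a\<in>A. \<Union>b\<in>B. presented_cong X R `` {a + b}),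
      one = presented_cong X R `` {{#}}\<rparr>"

lemma free_cm_add: "a + b \<in> free_cm X \<longleftrightarrow> a \<in> free_cm X \<and> b \<in> free_cm X"
  by (auto simp: free_cm_def)

lemma free_cm_empty: "{#} \<in> free_cm X"
  by (simp add: free_cm_def)

lemma presented_cong_subset:
  assumes "R \<subseteq> free_cm X \<times> free_cm X" and "(a, b) \<in> presented_cong X R"
  shows "a \<in> free_cm X \<and> b \<in> free_cm X"
  using assms(2) by induction (use assms(1) in \<open>auto simp: free_cm_add\<close>)

lemma equiv_presented_cong:
  assumes "R \<subseteq> free_cm X \<times> free_cm X"
  shows "equiv (free_cm X) (presented_cong X R)"
  using presented_cong_subset[OF assms]
  by (intro equivI)
     (auto simp: refl_on_def sym_def trans_def intro: presented_cong.intros)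

lemma presented_cong_add:
  assumes "R \<subseteq> free_cm X \<times> free_cm X"
    and "(a, a') \<in> presented_cong X R" and "(b, b') \<in> presented_cong X R"
  shows "(a + b, a' + b') \<in> presented_cong X R"
proof -
  have "(a + b, a' + b) \<in> presented_cong X R"
    using assms presented_cong_subset[OF assms(1)] by (blast intro: presented_cong.add)
  moreover have "(b + a', b' + a') \<in> presented_cong X R"
    using assms presented_cong_subset[OF assms(1)] by (blast intro: presented_cong.add)
  ultimately show ?thesis
    by (metis add.commute presented_cong.trans)
qed

lemma presented_monoid_mult_class:
  assumes R: "R \<subseteq> free_cm X \<times> free_cm X" and a: "a \<in> free_cm X" and b: "b \<in> free_cm X"
  shows "mult (presented_monoid X R) (presented_cong X R `` {a}) (presented_cong X R `` {b})
           = presented_cong X R `` {a + b}"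
proof -
  let ?C = "presented_cong X R"
  have cong: "(\<lambda>x y. ?C `` {x + y}) respects2 ?C"
    by (rule congruent2I'[OF equiv_class_eq[OF equiv_presented_cong[OF R]]])
       (rule presented_cong_add[OF R])
  show ?thesis
    using UN_equiv_class2[OF equiv_presented_cong[OF R] equiv_presented_cong[OF R] cong a b]
    by (simp add: presented_monoid_def)
qed

lemma comm_monoid_presented_monoid:
  assumes R: "R \<subseteq> free_cm X \<times> free_cm X"
  shows "comm_monoid (presented_monoid X R)"
proof -
  let ?C = "presented_cong X R" and ?M = "presented_monoid X R"
  have carr: "carrier ?M = free_cm X // ?C" and one: "one ?M = ?C `` {{#}}"
    by (simp_all add: presented_monoid_def)
  have cl: "?C `` {a} \<in> carrier ?M" if "a \<in> free_cm X" for a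
    using that by (simp add: carr quotientI)
  have ex: "\<exists>a\<in>free_cm X. A = ?C `` {a}" if "A \<in> carrier ?M" for A
    using that unfolding carr by (auto elim: quotientE)
  note mult = presented_monoid_mult_class[OF R]
  show ?thesis
  proof (rule comm_monoidI)
    show "mult ?M A B \<in> carrier ?M" if "A \<in> carrier ?M" "B \<in> carrier ?M" for A B
      using ex[OF that(1)] ex[OF that(2)] by (auto simp: mult free_cm_add intro!: cl)
    show "one ?M \<in> carrier ?M"
      by (simp add: one cl free_cm_empty)
    show "mult ?M (mult ?M A B) C = mult ?M A (mult ?M B C)"
      if "A \<in> carrier ?M" "B \<in> carrier ?M" "C \<in> carrier ?M" for A B C
      using ex[OF that(1)] ex[OF that(2)] ex[OF that(3)] by (auto simp: mult free_cm_add add.assoc)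
    show "mult ?M (one ?M) A = A" if "A \<in> carrier ?M" for A
      using ex[OF that] by (auto simp: one mult free_cm_empty)
    show "mult ?M A B = mult ?M B A" if "A \<in> carrier ?M" "B \<in> carrier ?M" for A B
      using ex[OF that(1)] ex[OF that(2)] by (auto simp: mult add.commute)
  qed
qed


section \<open>The weighted graph monoid\<close>

definition weight_count :: "('v, 'e) pre_digraph \<Rightarrow> ('e \<Rightarrow> nat) \<Rightarrow> 'v \<Rightarrow> nat" where
  "weight_count G w v = card (w ` out_arcs G v)"

text \<open>\<open>nth_weight G w v i\<close> is \<open>w\<^sub>i(v)\<close> for \<open>0 \<le> i \<le> k\<^sub>v\<close>, including \<open>w\<^sub>0(v) = 0\<close>.\<close>

definition nth_weight :: "('v, 'e) pre_digraph \<Rightarrow> ('e \<Rightarrow> nat) \<Rightarrow> 'v \<Rightarrow> nat \<Rightarrow> nat" where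
  "nth_weight G w v i = (0 # sorted_list_of_set (w ` out_arcs G v)) ! i"

datatype 'v monoid_gen = Vert 'v | Q 'v nat

definition monoid_gens :: "('v, 'e) pre_digraph \<Rightarrow> ('e \<Rightarrow> nat) \<Rightarrow> 'v monoid_gen set" where
  "monoid_gens G w = Vert ` verts G \<union> {Q v i | v i. v \<in> verts G \<and> 1 \<le> i \<and> i < weight_count G w v}"

text \<open>The conventions \<open>q\<^sub>0\<^sup>v = 0\<close> and \<open>q\<^sub>i\<^sup>v = 0\<close> for \<open>i = k\<^sub>v\<close>.\<close>

definition q_elem :: "('v, 'e) pre_digraph \<Rightarrow> ('e \<Rightarrow> nat) \<Rightarrow> 'v \<Rightarrow> nat \<Rightarrow> 'v monoid_gen multiset" where
  "q_elem G w v i = (if 1 \<le> i \<and> i < weight_count G w v then {#Q v i#} else {#})"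

definition monoid_rels ::
  "('v, 'e) pre_digraph \<Rightarrow> ('e \<Rightarrow> nat) \<Rightarrow> ('v monoid_gen multiset \<times> 'v monoid_gen multiset) set" where
  "monoid_rels G w =
     {(q_elem G w v (i - 1) + replicate_mset (nth_weight G w v i - nth_weight G w v (i - 1)) (Vert v),
       q_elem G w v i + (\<Sum>e | e \<in> out_arcs G v \<and> w e = nth_weight G w v i. {#Vert (head G e)#}))
      | v i. v \<in> verts G \<and> 1 \<le> i \<and> i \<le> weight_count G w v}"

definition weighted_graph_monoid ::
  "('v, 'e) pre_digraph \<Rightarrow> ('e \<Rightarrow> nat) \<Rightarrow> 'v monoid_gen multiset set monoid" where
  "weighted_graph_monoid G w = presented_monoid (monoid_gens G w) (monoid_rels G w)"

lemma (in weighted_graph) nth_weight_strict_mono: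
  assumes "v \<in> verts G" "i < j" "j \<le> weight_count G w v"
  shows "nth_weight G w v i < nth_weight G w v j"
proof -
  let ?S = "w ` out_arcs G v"
  have fin: "finite ?S" using row_finite[OF assms(1)] by simp
  have pos: "\<forall>x\<in>?S. 0 < x" using weight_pos by fastforce
  have "sorted_wrt (<) (0 # sorted_list_of_set ?S)"
    using pos fin by simp
  then show ?thesis
    unfolding nth_weight_def
    by (rule sorted_wrt_nth_less) (use assms in \<open>auto simp: weight_count_def\<close>)
qed

lemma (in weighted_graph) monoid_rels_subset:
  "monoid_rels G w \<subseteq> free_cm (monoid_gens G w) \<times> free_cm (monoid_gens G w)"
proof -
  have "(\<Sum>e | e \<in> out_arcs G v \<and> w e = n. {#Vert (head G e)#}) \<in> free_cm (monoid_gens G w)"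
    if "v \<in> verts G" for v n
  proof -
    have "finite {e. e \<in> out_arcs G v \<and> w e = n}"
      by (rule finite_subset[OF _ row_finite[OF that]]) auto
    moreover have "\<forall>e\<in>{e. e \<in> out_arcs G v \<and> w e = n}. {#Vert (head G e)#} \<in> free_cm (monoid_gens G w)"
      by (auto simp: free_cm_def monoid_gens_def)
    ultimately show ?thesis
      by (induction rule: finite_induct) (auto simp: free_cm_def)
  qed
  then show ?thesis
    by (auto simp: monoid_rels_def free_cm_add)
       (auto simp: q_elem_def free_cm_def monoid_gens_def split: if_splits)
qed

lemma (in weighted_graph) comm_monoid_weighted_graph_monoid:
  "comm_monoid (weighted_graph_monoid G w)"
  unfolding weighted_graph_monoid_def
  by (rule comm_monoid_presented_monoid[OF monoid_rels_subset])

lemma (in comm_monoid) comm_monoid_cancel_iff: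
  "comm_monoid_cancel G \<longleftrightarrow>
     (\<forall>a\<in>carrier G. \<forall>b\<in>carrier G. \<forall>c\<in>carrier G. a \<otimes>\<^bsub>G\<^esub> b = c \<otimes>\<^bsub>G\<^esub> b \<longrightarrow> a = c)"
proof
  assume "comm_monoid_cancel G"
  then interpret comm_monoid_cancel G .
  show "\<forall>a\<in>carrier G. \<forall>b\<in>carrier G. \<forall>c\<in>carrier G. a \<otimes>\<^bsub>G\<^esub> b = c \<otimes>\<^bsub>G\<^esub> b \<longrightarrow> a = c"
    by (auto intro: r_cancel)
next
  assume "\<forall>a\<in>carrier G. \<forall>b\<in>carrier G. \<forall>c\<in>carrier G. a \<otimes>\<^bsub>G\<^esub> b = c \<otimes>\<^bsub>G\<^esub> b \<longrightarrow> a = c"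
  then show "comm_monoid_cancel G"
    by unfold_locales (metis m_comm)+
qed

end

theory Submission
  imports Defs
begin

text \<open>The defining relations of the monoid turn out to be expansion rules: each of them equates a single
  vertex with a sum of generators, and no vertex is expanded by two rules. A vertex outside
  \<open>Z = T(r(E\<^sub>w))\<close> that emits unweighted edges expands to the sum of their ranges, plus \<open>q\<close> if it also
  emits a weighted edge. For an edge \<open>e\<close> that is weighted or starts in \<open>Z\<close> the relation has to be read
  backwards: the range \<open>r(e)\<close> expands to copies of \<open>s(e)\<close>, plus \<open>q\<close> if there is one. These edges are
  called reversed. By (LPA2), (LPA3) and acyclicity they have distinct ranges
  (\<open>inj_on_head_reversed\<close>), and all these ranges lie in \<open>Z\<close>, so that the rules do not compete. The
  generators \<open>q\<close> are never expanded. Drawing an arrow from a generator to each generator in its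
  expansion, the arrows between vertices are exactly the steps along arcs of the auxiliary graph of
  the P1-weighted graph (\<open>arrows_Vert_iff\<close>); the bar edges come from the weighted edges with source
  outside \<open>Z\<close>.

  If no cycle contains a bar edge, there is no cycle of arrows: without bar edges one can pass from
  outside \<open>Z\<close> into \<open>Z\<close> but never back, so that a cycle would be a cycle of the original graph, forwards
  outside \<open>Z\<close> or backwards inside \<open>Z\<close> (\<open>acyclic_plain_steps\<close>). With acyclic arrows, any finite set of
  rules can be expanded exhaustively, which gives an additive normal form. A congruence between two
  multisets uses finitely many rules, so \<open>a + b \<sim> c + b\<close> makes the normal forms of \<open>a + b\<close> and \<open>c + b\<close>
  equal for some such set. Free commutative monoids are cancellative, hence \<open>a\<close> and \<open>c\<close> have the same
  normal form, and \<open>a \<sim> c\<close> (\<open>cancel_if_acyclic\<close>).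

  If a bar edge from \<open>r(g)\<close> to \<open>s(g)\<close> lies on a cycle, then going around it expands \<open>r(g)\<close> to
  \<open>r(g) + d\<close>. Here \<open>d\<close> is nonzero since \<open>w(g) > 1\<close>: the expansion of \<open>r(g)\<close> contains \<open>s(g)\<close> and
  something else. Cancelling \<open>r(g)\<close> would give \<open>d \<sim> 0\<close>, but only the empty multiset is congruent to the
  empty multiset, because no relation has an empty side (\<open>not_cancel_if_cycle_with_exit\<close>).\<close>

section \<open>Oriented presentations of commutative monoids\<close>

lemma presented_monoid_cancel_iff:
  assumes R: "R \<subseteq> free_cm X \<times> free_cm X"
  shows "comm_monoid_cancel (presented_monoid X R) \<longleftrightarrow>
    (\<forall>a\<in>free_cm X. \<forall>b\<in>free_cm X. \<forall>c\<in>free_cm X.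
       (a + b, c + b) \<in> presented_cong X R \<longrightarrow> (a, c) \<in> presented_cong X R)"
proof -
  let ?C = "presented_cong X R" and ?M = "presented_monoid X R"
  interpret comm_monoid ?M by (rule comm_monoid_presented_monoid[OF R])
  have eq: "?C `` {a} = ?C `` {b} \<longleftrightarrow> (a, b) \<in> ?C" if "a \<in> free_cm X" "b \<in> free_cm X" for a b
    using that equiv_presented_cong[OF R] by (metis eq_equiv_class_iff)
  have carr: "carrier ?M = (\<lambda>a. ?C `` {a}) ` free_cm X"
    by (auto simp: presented_monoid_def quotient_def)
  show ?thesis
    unfolding comm_monoid_cancel_iff carr
    by (simp add: presented_monoid_mult_class[OF R] eq free_cm_add cong: ball_cong)
qed

abbreviation additive_ext :: "('g \<Rightarrow> 'h multiset) \<Rightarrow> 'g multiset \<Rightarrow> 'h multiset" where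
  "additive_ext f a \<equiv> (\<Sum>x\<in>#a. f x)"

lemma additive_ext_comp:
  "additive_ext (\<lambda>x. additive_ext f (g x)) a = additive_ext f (additive_ext g a)"
  by (induction a) auto

text \<open>A pair \<open>(x, m)\<close> is read as the rule that expands the generator \<open>x\<close> to \<open>m\<close>.\<close>

definition arrows :: "('g \<times> 'g multiset) set \<Rightarrow> ('g \<times> 'g) set" where
  "arrows L = {(x, y). \<exists>m. (x, m) \<in> L \<and> y \<in># m}"

lemma arrowsI: "(x, m) \<in> L \<Longrightarrow> y \<in># m \<Longrightarrow> (x, y) \<in> arrows L"
  by (auto simp: arrows_def)

locale oriented_presentation =
  fixes X :: "'g set" and R :: "('g multiset \<times> 'g multiset) set" and L :: "('g \<times> 'g multiset) set"
  assumes rels_subset: "R \<subseteq> free_cm X \<times> free_cm X"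
    and rule_is_rel: "(x, m) \<in> L \<Longrightarrow> ({#x#}, m) \<in> R \<union> R\<inverse>"
    and rel_is_rule: "(a, b) \<in> R \<Longrightarrow> \<exists>(x, m)\<in>L. (a, b) = ({#x#}, m) \<or> (a, b) = (m, {#x#})"
    and rule_nonempty: "(x, m) \<in> L \<Longrightarrow> m \<noteq> {#}"
begin

abbreviation "C \<equiv> presented_cong X R"

lemma rule_cong: "(x, m) \<in> L \<Longrightarrow> ({#x#}, m) \<in> C"
  using rule_is_rel[of x m] by (metis UnE converseD presented_cong.rel presented_cong.sym)

lemma cong_free: "(a, b) \<in> C \<Longrightarrow> a \<in> free_cm X \<and> b \<in> free_cm X"
  by (rule presented_cong_subset[OF rels_subset])

lemma cong_empty_iff: "(a, b) \<in> C \<Longrightarrow> a = {#} \<longleftrightarrow> b = {#}"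
proof (induction rule: presented_cong.induct)
  case (rel a b)
  then obtain x m where "(x, m) \<in> L" "(a, b) = ({#x#}, m) \<or> (a, b) = (m, {#x#})"
    using rel_is_rule by blast
  then show ?case using rule_nonempty by auto
qed auto

text \<open>Expanding along a path of arrows produces its endpoint, and everything else that is produced on
  the way is collected in \<open>d\<close>.\<close>

lemma arrows_summand:
  assumes "(x, y) \<in> (arrows L)\<^sup>*" "x \<in> X"
  shows "\<exists>d. ({#x#}, {#y#} + d) \<in> C"
  using assms(1)
proof induction
  case base
  have "({#x#}, {#x#} + {#}) \<in> C"
    using assms(2) by (auto intro: presented_cong.refl simp: free_cm_def)
  then show ?case ..
next
  case (step y z)
  then obtain d m where d: "({#x#}, {#y#} + d) \<in> C" and m: "(y, m) \<in> L" "z \<in># m"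
    by (auto simp: arrows_def)
  have "d \<in> free_cm X"
    using cong_free[OF d] by (simp add: free_cm_def)
  then have "({#y#} + d, m + d) \<in> C"
    using rule_cong[OF m(1)] by (rule presented_cong.add[rotated])
  with d have "({#x#}, m + d) \<in> C" by (rule presented_cong.trans)
  moreover have "m + d = {#z#} + (m - {#z#} + d)"
    using m(2) by simp
  ultimately show ?case by metis
qed

text \<open>The rest \<open>m - {#y#}\<close> is the exit: one turn around the cycle reproduces \<open>x\<close> and leaves at least
  this nonempty multiset behind.\<close>

lemma not_cancel_if_cycle_with_exit:
  assumes "(x, m) \<in> L" "y \<in># m" "m \<noteq> {#y#}" "(y, x) \<in> (arrows L)\<^sup>*"
  shows "\<not> comm_monoid_cancel (presented_monoid X R)"
proof
  assume "comm_monoid_cancel (presented_monoid X R)"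
  then have cancel: "(a, c) \<in> C" if "(a + b, c + b) \<in> C" for a b c
    using that cong_free[OF that] by (auto simp: presented_monoid_cancel_iff[OF rels_subset] free_cm_add)
  define r where "r = m - {#y#}"
  have m: "m = {#y#} + r" and "r \<noteq> {#}"
    using assms(2,3) by (auto simp: r_def dest: multi_member_split)
  have xm: "({#x#}, {#y#} + r) \<in> C"
    using rule_cong[OF assms(1)] unfolding m .
  then have free: "x \<in> X" "y \<in> X" "r \<in> free_cm X"
    using cong_free[OF xm] by (auto simp: free_cm_def)
  obtain d where d: "({#y#}, {#x#} + d) \<in> C"
    using arrows_summand[OF assms(4) free(2)] by blast
  have "({#x#}, {#x#} + d + r) \<in> C"
    using xm presented_cong.add[OF d free(3)] by (rule presented_cong.trans)
  then have "({#} + {#x#}, (d + r) + {#x#}) \<in> C"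
    by (simp add: ac_simps)
  then have "({#}, d + r) \<in> C" by (rule cancel)
  with \<open>r \<noteq> {#}\<close> show False using cong_empty_iff by auto
qed

text \<open>A congruence has a finite derivation, so an additive map that respects the finitely many rules in
  it already identifies both sides. The conclusion speaks of additive maps rather than of a congruence
  generated by \<open>L0\<close>; this makes transitivity a mere union of the two sets of rules.\<close>

lemma cong_finite_rules:
  assumes "(a, b) \<in> C"
  shows "\<exists>L0. finite L0 \<and> L0 \<subseteq> L \<and>
    (\<forall>f :: 'g \<Rightarrow> 'g multiset. (\<forall>(x, m)\<in>L0. f x = additive_ext f m) \<longrightarrow> additive_ext f a = additive_ext f b)"
  using assms
proof induction
  case (rel a b)
  then obtain x m where "(x, m) \<in> L" "(a, b) = ({#x#}, m) \<or> (a, b) = (m, {#x#})"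
    using rel_is_rule by blast
  then show ?case by (intro exI[of _ "{(x, m)}"]) auto
next
  case (refl a)
  show ?case by (intro exI[of _ "{}"]) auto
next
  case (sym a b)
  then show ?case by metis
next
  case (trans a b c)
  then obtain L1 L2 where
    1: "finite L1" "L1 \<subseteq> L" "\<And>f :: 'g \<Rightarrow> 'g multiset.
      \<forall>(x, m)\<in>L1. f x = additive_ext f m \<Longrightarrow> additive_ext f a = additive_ext f b" and
    2: "finite L2" "L2 \<subseteq> L" "\<And>f :: 'g \<Rightarrow> 'g multiset.
      \<forall>(x, m)\<in>L2. f x = additive_ext f m \<Longrightarrow> additive_ext f b = additive_ext f c"
    by blast
  show ?case
    by (intro exI[of _ "L1 \<union> L2"] conjI allI impI)
       (use 1 2 in \<open>auto simp: ball_Un\<close>)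
next
  case (add a b c)
  then obtain L1 where
    1: "finite L1" "L1 \<subseteq> L" "\<And>f :: 'g \<Rightarrow> 'g multiset.
      \<forall>(x, m)\<in>L1. f x = additive_ext f m \<Longrightarrow> additive_ext f a = additive_ext f b"
    by blast
  show ?case
    by (intro exI[of _ L1] conjI allI impI) (simp_all add: 1)
qed

text \<open>Replacing each generator by something congruent to it does not leave the congruence class.\<close>

lemma cong_additive_ext:
  assumes "\<And>x. x \<in> X \<Longrightarrow> ({#x#}, f x) \<in> C" "a \<in> free_cm X"
  shows "(a, additive_ext f a) \<in> C"
  using assms(2)
proof (induction a)
  case empty
  then show ?case by (simp add: presented_cong.refl)
next
  case (add x a)
  then have "({#x#}, f x) \<in> C" "(a, additive_ext f a) \<in> C"
    by (auto simp: free_cm_def assms(1))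
  from presented_cong_add[OF rels_subset this] show ?case by simp
qed

text \<open>The map \<open>f\<close> expands exhaustively by the rules in \<open>L0\<close>, and is built by adding one rule \<open>(x, m)\<close> at
  a time: bring \<open>m\<close> into its old normal form \<open>M\<close> and substitute \<open>M\<close> for \<open>x\<close> in all old normal forms.
  This respects the old rules because it is composition with an additive map. It respects the new one
  because \<open>x\<close> does not occur in \<open>M\<close>: normal forms consist of descendants, and \<open>x\<close> is not a proper
  descendant of itself. The second and the last conjunct are there to carry this induction.\<close>

lemma normal_form:
  assumes "single_valued L" "acyclic (arrows L)" "finite L0" "L0 \<subseteq> L"
  shows "\<exists>f. (\<forall>(x, m)\<in>L0. f x = additive_ext f m) \<and> (\<forall>x. x \<notin> fst ` L0 \<longrightarrow> f x = {#x#}) \<and>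
    (\<forall>x\<in>X. ({#x#}, f x) \<in> C) \<and> (\<forall>x. \<forall>y\<in>#f x. (x, y) \<in> (arrows L)\<^sup>*)"
  using assms(3,4)
proof (induction L0)
  case empty
  show ?case
    by (intro exI[of _ "\<lambda>x. {#x#}"]) (auto intro: presented_cong.refl simp: free_cm_def)
next
  case (insert r L0)
  obtain x m where r: "r = (x, m)" by force
  have "L0 \<subseteq> L" using insert.prems by simp
  from insert.IH[OF this] obtain f where
    f_rule: "\<forall>(y, n)\<in>L0. f y = additive_ext f n" and
    f_triv: "\<forall>y. y \<notin> fst ` L0 \<longrightarrow> f y = {#y#}" and
    f_cong: "\<forall>y\<in>X. ({#y#}, f y) \<in> C" and
    f_desc: "\<forall>y. \<forall>z\<in>#f y. (y, z) \<in> (arrows L)\<^sup>*"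
    by (elim exE conjE)
  note f_rule = f_rule[rule_format] and f_triv = f_triv[rule_format]
    and f_cong = f_cong[rule_format] and f_desc = f_desc[rule_format]
  have xm: "(x, m) \<in> L" "(x, m) \<notin> L0" using insert.hyps insert.prems r by auto
  have x_new: "x \<notin> fst ` L0"
    using xm insert.prems assms(1) by (force dest: single_valuedD)
  define M where "M = additive_ext f m"
  define s where "s = (\<lambda>z. if z = x then M else {#z#})"
  define f' where "f' = (\<lambda>y. additive_ext s (f y))"
  have M_desc: "(x, z) \<in> (arrows L)\<^sup>+" if "z \<in># M" for z
  proof -
    from that obtain y where "y \<in># m" "z \<in># f y" by (auto simp: M_def)
    then show ?thesis
      using arrowsI[OF xm(1)] f_desc by (metis rtrancl_into_trancl2)
  qed
  have s_other: "additive_ext s a = a" if "x \<notin># a" for a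
  proof -
    have "additive_ext s a = (\<Sum>z\<in>#a. {#z#})"
      using that by (intro arg_cong[of _ _ sum_mset] image_mset_cong) (auto simp: s_def)
    then show ?thesis by simp
  qed
  have s_M: "additive_ext s M = M"
    using M_desc assms(2) by (intro s_other) (auto simp: acyclic_def)
  have f'_ext: "additive_ext f' a = additive_ext s (additive_ext f a)" for a
    unfolding f'_def by (rule additive_ext_comp)
  have f'_x: "f' x = M"
    by (simp add: f'_def f_triv[OF x_new] s_def)
  have m_free: "m \<in> free_cm X" "x \<in> X"
    using cong_free[OF rule_cong[OF xm(1)]] by (auto simp: free_cm_def)
  have "(m, M) \<in> C"
    unfolding M_def using f_cong m_free by (intro cong_additive_ext)
  with rule_cong[OF xm(1)] have xM: "({#x#}, M) \<in> C" by (rule presented_cong.trans)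
  show ?case
  proof (intro exI[of _ f'] conjI ballI allI impI)
    fix p assume "p \<in> insert r L0"
    then show "case p of (y, n) \<Rightarrow> f' y = additive_ext f' n"
    proof
      assume "p = r"
      then show ?thesis by (simp add: r f'_x f'_ext M_def[symmetric] s_M)
    next
      assume "p \<in> L0"
      then show ?thesis using f_rule by (auto simp: f'_ext) (auto simp: f'_def)
    qed
  next
    fix y assume "y \<notin> fst ` insert r L0"
    then show "f' y = {#y#}" by (auto simp: f'_def f_triv r s_def)
  next
    fix y assume y: "y \<in> X"
    have "({#z#}, s z) \<in> C" if "z \<in> X" for z
      using that xM by (auto simp: s_def free_cm_def intro: presented_cong.refl)
    then have "(f y, f' y) \<in> C"
      unfolding f'_def using cong_free[OF f_cong[OF y]] by (intro cong_additive_ext) auto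
    with f_cong[OF y] show "({#y#}, f' y) \<in> C" by (rule presented_cong.trans)
  next
    fix y z assume "z \<in># f' y"
    then obtain u where "u \<in># f y" "z \<in># s u" by (auto simp: f'_def)
    then show "(y, z) \<in> (arrows L)\<^sup>*"
      using f_desc[of u y] M_desc[of z] by (auto simp: s_def split: if_splits)
  qed
qed

lemma cancel_if_acyclic:
  assumes "single_valued L" "acyclic (arrows L)"
  shows "comm_monoid_cancel (presented_monoid X R)"
  unfolding presented_monoid_cancel_iff[OF rels_subset]
proof (intro ballI impI)
  fix a b c assume free: "a \<in> free_cm X" "b \<in> free_cm X" "c \<in> free_cm X"
    and eq: "(a + b, c + b) \<in> C"
  obtain L0 where L0: "finite L0" "L0 \<subseteq> L" "\<And>f :: 'g \<Rightarrow> 'g multiset.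
      \<forall>(x, m)\<in>L0. f x = additive_ext f m \<Longrightarrow> additive_ext f (a + b) = additive_ext f (c + b)"
    using cong_finite_rules[OF eq] by blast
  obtain f where f: "\<forall>(x, m)\<in>L0. f x = additive_ext f m" "\<And>x. x \<in> X \<Longrightarrow> ({#x#}, f x) \<in> C"
    using normal_form[OF assms L0(1,2)] by blast
  have "additive_ext f a = additive_ext f c"
    using L0(3)[OF f(1)] by simp
  then show "(a, c) \<in> C"
    using cong_additive_ext[of f, OF f(2) free(1)] cong_additive_ext[of f, OF f(2) free(3)]
    by (metis presented_cong.sym presented_cong.trans)
qed

end


section \<open>Closed walks and cycles\<close>

lemma (in wf_digraph) cycle_through_arc:
  assumes e: "e \<in> arcs G" and "head G e \<rightarrow>\<^sup>* tail G e"
  shows "\<exists>p. cycle p \<and> e \<in> set p"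
proof -
  obtain q where q: "apath (head G e) q (tail G e)"
    using assms(2) by (auto simp: reachable_apath)
  then have "awalk (tail G e) (e # q) (tail G e)" "distinct (tl (awalk_verts (tail G e) (e # q)))"
    using e by (auto simp: apath_def awalk_Cons_iff)
  then show ?thesis
    by (intro exI[of _ "e # q"]) (auto simp: cycle_def)
qed

lemma (in wf_digraph) cycle_arc_reachable:
  assumes "cycle p" "e \<in> set p"
  shows "e \<in> arcs G" "head G e \<rightarrow>\<^sup>* tail G e"
proof -
  obtain u where u: "awalk u p u" using assms(1) by (auto simp: cycle_def)
  obtain q r where p: "p = q @ e # r" using assms(2) by (meson split_list)
  from u have qr: "awalk u q (tail G e)" "e \<in> arcs G" "awalk (head G e) r u"
    by (auto simp: p awalk_Cons_iff)
  then show "e \<in> arcs G" "head G e \<rightarrow>\<^sup>* tail G e"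
    by (auto intro: reachable_awalkI reachable_trans)
qed

lemma (in wf_digraph) acyclic_arcs_ends:
  assumes "acyclic_digraph G"
  shows "acyclic (arcs_ends G)"
  unfolding acyclic_def
proof (intro allI notI)
  fix x assume "x \<rightarrow>\<^sup>+ x"
  then obtain y where y: "x \<rightarrow> y" "(y, x) \<in> (arcs_ends G)\<^sup>*" by (meson tranclD)
  then obtain e where e: "e \<in> arcs G" "tail G e = x" "head G e = y" by auto
  then have "head G e \<rightarrow>\<^sup>* tail G e" using y by (auto simp: reachable_conv')
  with e(1) show False
    using cycle_through_arc assms unfolding acyclic_digraph_def by blast
qed

text \<open>A closed walk that uses a step \<open>(a, b)\<close> of \<open>B\<close> returns from \<open>b\<close> to \<open>a\<close>.\<close>

lemma acyclic_Un_if_no_back_path: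
  assumes "acyclic P" and no_return: "\<And>a b. (a, b) \<in> B \<Longrightarrow> (b, a) \<notin> (P \<union> B)\<^sup>*"
  shows "acyclic (P \<union> B)"
proof -
  have "(x, y) \<in> P\<^sup>+ \<or> (\<exists>(a, b)\<in>B. (x, a) \<in> (P \<union> B)\<^sup>* \<and> (b, y) \<in> (P \<union> B)\<^sup>*)"
    if "(x, y) \<in> (P \<union> B)\<^sup>+" for x y
    using that
  proof induction
    case (base y)
    then show ?case by auto
  next
    case (step y z)
    from step.IH show ?case
    proof
      assume P: "(x, y) \<in> P\<^sup>+"
      have "(x, y) \<in> (P \<union> B)\<^sup>*" using step.hyps(1) by (rule trancl_into_rtrancl)
      with P step.hyps(2) show ?case by (auto intro: trancl_into_trancl)
    next
      assume "\<exists>(a, b)\<in>B. (x, a) \<in> (P \<union> B)\<^sup>* \<and> (b, y) \<in> (P \<union> B)\<^sup>*"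
      with step.hyps(2) show ?case by (blast intro: rtrancl_into_rtrancl)
    qed
  qed
  then show ?thesis
    using assms unfolding acyclic_def by (fast intro: rtrancl_trans)
qed


section \<open>Acyclic weighted graphs satisfying (LPA)\<close>

definition reversed_arcs :: "('v, 'e) pre_digraph \<Rightarrow> ('e \<Rightarrow> nat) \<Rightarrow> 'e set" where
  "reversed_arcs G w = {e \<in> arcs G. 1 < w e \<or> tail G e \<in> weighted_tree G w}"

locale acyclic_lpa_graph = lpa_weighted_graph G w
  for G :: "('v, 'e) pre_digraph" (structure) and w :: "'e \<Rightarrow> nat" +
  assumes acyclic: "acyclic_digraph G"
begin

abbreviation "Z \<equiv> weighted_tree G w"

lemma weighted_tree_iff: "z \<in> Z \<longleftrightarrow> (\<exists>h\<in>arcs G. 1 < w h \<and> head G h \<rightarrow>\<^sup>* z)"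
  by (auto simp: weighted_tree_def tree_from_set_def tree_from_def weighted_arcs_def)

lemma weighted_tree_reachable: "z \<in> Z \<Longrightarrow> z \<rightarrow>\<^sup>* y \<Longrightarrow> y \<in> Z"
  unfolding weighted_tree_iff by (blast intro: reachable_trans)

lemma weighted_tree_arc_unique:
  "e \<in> arcs G \<Longrightarrow> f \<in> arcs G \<Longrightarrow> tail G e \<in> Z \<Longrightarrow> tail G f = tail G e \<Longrightarrow> e = f"
  by (rule LPA2[of "tail G e"]) auto

lemma arc_reachable: "e \<in> arcs G \<Longrightarrow> tail G e \<rightarrow>\<^sup>* head G e"
  by (rule reachable_adjI) (auto simp: arcs_ends_conv)

lemma arc_no_return: "e \<in> arcs G \<Longrightarrow> \<not> head G e \<rightarrow>\<^sup>* tail G e"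
  using cycle_through_arc acyclic unfolding acyclic_digraph_def by blast

text \<open>By (LPA2) a vertex of \<open>Z\<close> emits at most one edge, so every walk out of it starts along that edge.\<close>

lemma weighted_tree_next:
  assumes "a \<in> arcs G" "tail G a \<in> Z" "tail G a \<rightarrow>\<^sup>* y" "tail G a \<noteq> y"
  shows "head G a \<rightarrow>\<^sup>* y"
proof -
  obtain x where x: "tail G a \<rightarrow> x" "(x, y) \<in> (arcs_ends G)\<^sup>*"
    using assms(3,4) by (meson reachable_neq_reachable1 tranclD)
  then obtain b where "b \<in> arcs G" "tail G b = tail G a" "head G b = x"
    by (auto simp: arcs_ends_conv)
  then have "x = head G a"
    using weighted_tree_arc_unique[OF assms(1) _ assms(2)] by metis
  then show ?thesis
    using x(2) assms(1) by (simp add: reachable_conv')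
qed

lemma weighted_tree_linear:
  assumes "z \<in> Z" "z \<rightarrow>\<^sup>* a" "z \<rightarrow>\<^sup>* b"
  shows "a \<rightarrow>\<^sup>* b \<or> b \<rightarrow>\<^sup>* a"
  using assms(2)
proof (induction rule: reachable_induct)
  case base
  then show ?case using assms(3) by simp
next
  case (step x y)
  obtain e where e: "e \<in> arcs G" "tail G e = x" "head G e = y"
    using step.hyps(2) by (auto simp: arcs_ends_conv)
  have "x \<in> Z" using assms(1) step.hyps(1) by (rule weighted_tree_reachable)
  from step.IH show ?case
  proof
    assume "x \<rightarrow>\<^sup>* b"
    then show ?thesis
      using weighted_tree_next[of e b] e \<open>x \<in> Z\<close> step.hyps(2) by (cases "x = b") auto
  next
    assume "b \<rightarrow>\<^sup>* x"
    then show ?thesis using step.hyps(2) by (blast intro: reachable_adj_trans)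
  qed
qed

lemma reversed_arc_origin:
  assumes "e \<in> reversed_arcs G w"
  obtains h where "h \<in> weighted_arcs G w" "h = e \<or> head G h \<rightarrow>\<^sup>* tail G e"
  using assms by (auto simp: reversed_arcs_def weighted_tree_iff weighted_arcs_def)

text \<open>Suppose that two reversed edges have the same range \<open>u\<close>. Each of them lies on the line that some
  weighted edge starts, and both lines pass through \<open>u\<close>, so by (LPA3) the two weighted edges are in
  line. Hence one of the lines contains both edges, up to its initial weighted edge. Following that
  line, one edge comes before the other, and so \<open>u\<close> is visited twice, contrary to acyclicity.\<close>

lemma inj_on_head_reversed: "inj_on (head G) (reversed_arcs G w)"
proof -
  \<comment> \<open>the case in which the line that \<open>h\<close> starts, which carries \<open>e\<close>, also reaches the source of \<open>f\<close>\<close>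
  have later: "e = f" if e: "e \<in> arcs G" and f: "f \<in> arcs G" and he: "head G e = head G f"
    and h: "h \<in> weighted_arcs G w" "h = e \<or> head G h \<rightarrow>\<^sup>* tail G e"
    and hf: "head G h \<rightarrow>\<^sup>* tail G f" for e f h
  proof (rule ccontr)
    assume "e \<noteq> f"
    have hZ: "head G h \<in> Z"
      using h(1) unfolding weighted_tree_iff weighted_arcs_def by auto
    have no: "\<not> head G e \<rightarrow>\<^sup>* tail G f" "\<not> head G f \<rightarrow>\<^sup>* tail G e"
      using arc_no_return e f he by metis+
    then have "head G h \<rightarrow>\<^sup>* tail G e" using h(2) hf by auto
    with hZ hf have "tail G e \<rightarrow>\<^sup>* tail G f \<or> tail G f \<rightarrow>\<^sup>* tail G e" and Z: "tail G e \<in> Z" "tail G f \<in> Z"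
      using weighted_tree_linear weighted_tree_reachable by blast+
    moreover have "tail G e \<noteq> tail G f"
      using weighted_tree_arc_unique e f Z \<open>e \<noteq> f\<close> by metis
    ultimately show False
      using weighted_tree_next[of e "tail G f"] weighted_tree_next[of f "tail G e"] e f no by metis
  qed
  show ?thesis
  proof (rule inj_onI)
    fix e f assume e: "e \<in> reversed_arcs G w" and f: "f \<in> reversed_arcs G w" and he: "head G e = head G f"
    have arcs: "e \<in> arcs G" "f \<in> arcs G" using e f by (auto simp: reversed_arcs_def)
    obtain h where h: "h \<in> weighted_arcs G w" "h = e \<or> head G h \<rightarrow>\<^sup>* tail G e"
      using e by (rule reversed_arc_origin)
    obtain k where k: "k \<in> weighted_arcs G w" "k = f \<or> head G k \<rightarrow>\<^sup>* tail G f"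
      using f by (rule reversed_arc_origin)
    have hk_arcs: "h \<in> arcs G" "k \<in> arcs G" using h(1) k(1) by (auto simp: weighted_arcs_def)
    have to_head: "head G h' \<rightarrow>\<^sup>* head G e'" if "h' = e' \<or> head G h' \<rightarrow>\<^sup>* tail G e'" "e' \<in> arcs G" for h' e'
      using that arc_reachable reachable_trans by (metis head_in_verts reachable_refl)
    have "head G e \<in> tree_from G (head G h) \<inter> tree_from G (head G k)"
      using to_head[OF h(2) arcs(1)] to_head[OF k(2) arcs(2)] he by (simp add: tree_from_def)
    then have "in_line G h k" using LPA3[OF h(1) k(1)] by blast
    then consider "h = k" | "head G h \<rightarrow>\<^sup>* tail G k" | "head G k \<rightarrow>\<^sup>* tail G h"
      by (auto simp: in_line_def)
    then show "e = f"
    proof cases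
      case 1
      then show ?thesis
        using h k later[OF arcs he] later[OF arcs(2,1) he[symmetric]] by metis
    next
      case 2
      then have "head G h \<rightarrow>\<^sup>* tail G f"
        using k(2) arc_reachable[OF hk_arcs(2)] by (metis reachable_trans)
      with later[OF arcs he h] show ?thesis .
    next
      case 3
      then have "head G k \<rightarrow>\<^sup>* tail G e"
        using h(2) arc_reachable[OF hk_arcs(1)] by (metis reachable_trans)
      with later[OF arcs(2,1) he[symmetric] k] show ?thesis by simp
    qed
  qed
qed

end


section \<open>The weighted graph monoid as an oriented presentation\<close>

context weighted_graph
begin

lemma nth_weight_0: "nth_weight G w v 0 = 0"
  by (simp add: nth_weight_def)

lemma nth_weight_attained:
  assumes "v \<in> verts G" "1 \<le> i" "i \<le> weight_count G w v"
  obtains e where "e \<in> out_arcs G v" "w e = nth_weight G w v i"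
proof -
  let ?S = "w ` out_arcs G v"
  have "nth_weight G w v i = sorted_list_of_set ?S ! (i - 1)" "i - 1 < card ?S"
    using assms(2,3) by (auto simp: nth_weight_def weight_count_def nth_Cons')
  then have "nth_weight G w v i \<in> ?S"
    using row_finite[OF assms(1)] nth_mem[of "i - 1" "sorted_list_of_set ?S"] by simp
  then show thesis using that by auto
qed

lemma nth_weight_surj:
  assumes "e \<in> out_arcs G v"
  obtains i where "1 \<le> i" "i \<le> weight_count G w v" "nth_weight G w v i = w e"
proof -
  let ?S = "w ` out_arcs G v"
  have "finite ?S" using row_finite[of v] assms by auto
  then obtain j where "j < card ?S" "sorted_list_of_set ?S ! j = w e"
    using assms by (metis imageI in_set_conv_nth length_sorted_list_of_set set_sorted_list_of_set)
  then show thesis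
    by (intro that[of "Suc j"]) (auto simp: nth_weight_def weight_count_def)
qed

lemma nth_weight_inj:
  assumes "v \<in> verts G" "i \<le> weight_count G w v" "j \<le> weight_count G w v"
    "nth_weight G w v i = nth_weight G w v j"
  shows "i = j"
  using assms nth_weight_strict_mono by (metis less_irrefl nat_neq_iff)

lemma first_weight_1:
  assumes "e \<in> out_arcs G v" "w e = 1"
  shows "1 \<le> weight_count G w v" "nth_weight G w v 1 = 1"
proof -
  have v: "v \<in> verts G" using assms(1) by auto
  obtain i where i: "1 \<le> i" "i \<le> weight_count G w v" "nth_weight G w v i = 1"
    using nth_weight_surj[OF assms(1)] assms(2) by metis
  then show k: "1 \<le> weight_count G w v" by simp
  have "0 < nth_weight G w v 1"
    using nth_weight_strict_mono[OF v, of 0 1] k by (simp add: nth_weight_0)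
  moreover have "nth_weight G w v 1 \<le> 1"
    using nth_weight_strict_mono[OF v, of 1 i] i by (cases "i = 1") auto
  ultimately show "nth_weight G w v 1 = 1" by simp
qed

end

text \<open>The relation at \<open>s(e)\<close> for the largest weight, solved for \<open>r(e)\<close>. The index \<open>k - 1\<close> is \<open>0\<close> when
  \<open>s(e)\<close> emits edges of one weight only; then \<open>q\<^sub>0 = 0\<close> and \<open>w\<^sub>0 = 0\<close>, and what remains are \<open>w(e)\<close> copies
  of \<open>s(e)\<close>.\<close>

definition reversed_side :: "('v, 'e) pre_digraph \<Rightarrow> ('e \<Rightarrow> nat) \<Rightarrow> 'e \<Rightarrow> 'v monoid_gen multiset" where
  "reversed_side G w e =
     (let v = tail G e; k = weight_count G w v
      in q_elem G w v (k - 1) + replicate_mset (w e - nth_weight G w v (k - 1)) (Vert v))"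

text \<open>The relation at \<open>v\<close> for the weight \<open>1\<close>, which expands a single copy of \<open>v\<close>. The first summand is
  empty unless \<open>v\<close> also emits a weighted edge.\<close>

definition kept_side :: "('v, 'e) pre_digraph \<Rightarrow> ('e \<Rightarrow> nat) \<Rightarrow> 'v \<Rightarrow> 'v monoid_gen multiset" where
  "kept_side G w v =
     q_elem G w v 1 + (\<Sum>e | e \<in> out_arcs G v \<and> w e = 1. {#Vert (head G e)#})"

definition expansion_rules ::
  "('v, 'e) pre_digraph \<Rightarrow> ('e \<Rightarrow> nat) \<Rightarrow> ('v monoid_gen \<times> 'v monoid_gen multiset) set" where
  "expansion_rules G w =
     {(Vert (head G e), reversed_side G w e) | e. e \<in> reversed_arcs G w} \<union>
     {(Vert v, kept_side G w v) | v. v \<notin> weighted_tree G w \<and> (\<exists>e\<in>out_arcs G v. w e = 1)}"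

context acyclic_lpa_graph
begin

lemma head_reversed: "e \<in> reversed_arcs G w \<Longrightarrow> head G e \<in> Z"
  using reversed_arc_origin arc_reachable reachable_trans
  unfolding weighted_tree_iff reversed_arcs_def weighted_arcs_def
  by (metis (no_types, lifting) head_in_verts mem_Collect_eq reachable_refl)

lemma single_valued_expansion_rules: "single_valued (expansion_rules G w)"
  using inj_on_head_reversed head_reversed
  by (auto simp: single_valued_def expansion_rules_def dest: inj_onD)

text \<open>Either \<open>e\<close> is the only edge that its source emits, or it is weighted and all the others are
  unweighted by (LPA1). The relation for the largest weight therefore has \<open>r(e)\<close> alone on one side.\<close>

lemma reversed_arc_heaviest:
  assumes "e \<in> reversed_arcs G w" "f \<in> out_arcs G (tail G e)" "f \<noteq> e"
  shows "w f < w e"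
proof -
  have arcs: "e \<in> arcs G" "f \<in> arcs G" "tail G f = tail G e"
    using assms by (auto simp: reversed_arcs_def)
  then have "tail G e \<notin> Z"
    using weighted_tree_arc_unique assms(3) by metis
  then have "1 < w e" using assms(1) by (simp add: reversed_arcs_def)
  moreover have "\<not> 1 < w f"
    using LPA1[of e f] \<open>1 < w e\<close> arcs assms(3) by (auto simp: weighted_arcs_def)
  ultimately show ?thesis by simp
qed

lemma reversed_arc_last_weight:
  assumes "e \<in> reversed_arcs G w"
  shows "1 \<le> weight_count G w (tail G e)" "nth_weight G w (tail G e) (weight_count G w (tail G e)) = w e"
proof -
  let ?v = "tail G e"
  have e: "e \<in> out_arcs G ?v" "?v \<in> verts G" using assms by (auto simp: reversed_arcs_def)
  obtain i where i: "1 \<le> i" "i \<le> weight_count G w ?v" "nth_weight G w ?v i = w e"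
    using nth_weight_surj[OF e(1)] by metis
  then show k: "1 \<le> weight_count G w ?v" by simp
  obtain f where f: "f \<in> out_arcs G ?v" "w f = nth_weight G w ?v (weight_count G w ?v)"
    using nth_weight_attained[OF e(2) k] by auto
  then show "nth_weight G w ?v (weight_count G w ?v) = w e"
    using nth_weight_strict_mono[OF e(2), of i "weight_count G w ?v"] i f(2)
      reversed_arc_heaviest[OF assms f(1)]
    by (cases "i = weight_count G w ?v"; cases "f = e") auto
qed

lemma reversed_arc_weight_unique:
  assumes "e \<in> reversed_arcs G w"
  shows "{f \<in> out_arcs G (tail G e). w f = w e} = {e}"
  using reversed_arc_heaviest[OF assms] assms by (fastforce simp: reversed_arcs_def)

lemma reversed_side_rel:
  assumes "e \<in> reversed_arcs G w"
  shows "(reversed_side G w e, {#Vert (head G e)#}) \<in> monoid_rels G w"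
proof -
  let ?v = "tail G e"
  have "?v \<in> verts G" using assms by (auto simp: reversed_arcs_def)
  then show ?thesis
    unfolding monoid_rels_def
    using reversed_arc_last_weight[OF assms] reversed_arc_weight_unique[OF assms]
    by (intro CollectI exI[of _ ?v] exI[of _ "weight_count G w ?v"])
       (simp add: reversed_side_def Let_def q_elem_def)
qed

lemma kept_side_rel:
  assumes "e \<in> out_arcs G v" "w e = 1"
  shows "({#Vert v#}, kept_side G w v) \<in> monoid_rels G w"
proof -
  have "v \<in> verts G" using assms(1) by auto
  then show ?thesis
    unfolding monoid_rels_def
    using first_weight_1[OF assms]
    by (intro CollectI exI[of _ v] exI[of _ 1])
       (simp add: kept_side_def q_elem_def nth_weight_0)
qed

text \<open>Which rule the \<open>i\<close>-th relation at \<open>v\<close> becomes is decided by an edge \<open>e\<close> of the \<open>i\<close>-th weight: if it is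
  reversed, then \<open>i\<close> is the last index, and otherwise \<open>e\<close> is unweighted and \<open>i = 1\<close>.\<close>

lemma rel_is_expansion_rule:
  assumes "(a, b) \<in> monoid_rels G w"
  shows "\<exists>(x, m)\<in>expansion_rules G w. (a, b) = ({#x#}, m) \<or> (a, b) = (m, {#x#})"
proof -
  obtain v i where v: "v \<in> verts G" and i: "1 \<le> i" "i \<le> weight_count G w v"
    and a: "a = q_elem G w v (i - 1) + replicate_mset (nth_weight G w v i - nth_weight G w v (i - 1)) (Vert v)"
    and b: "b = q_elem G w v i + (\<Sum>e | e \<in> out_arcs G v \<and> w e = nth_weight G w v i. {#Vert (head G e)#})"
    using assms unfolding monoid_rels_def by blast
  obtain e where e: "e \<in> out_arcs G v" "w e = nth_weight G w v i"
    using nth_weight_attained[OF v i] .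
  then have te: "e \<in> arcs G" "tail G e = v" by auto
  show ?thesis
  proof (cases "e \<in> reversed_arcs G w")
    case True
    have k: "i = weight_count G w v"
      using nth_weight_inj[OF v i(2) order_refl] reversed_arc_last_weight(2)[OF True] e(2) te by simp
    have "a = reversed_side G w e"
      by (simp add: a reversed_side_def Let_def te e(2) k)
    moreover have "b = {#Vert (head G e)#}"
      using reversed_arc_weight_unique[OF True] by (simp add: b te e(2) flip: k, simp add: k q_elem_def)
    ultimately show ?thesis
      using True by (intro bexI[of _ "(Vert (head G e), reversed_side G w e)"]) (auto simp: expansion_rules_def)
  next
    case False
    then have vZ: "v \<notin> Z" and "w e = 1"
      using te weight_pos[of e] by (auto simp: reversed_arcs_def)
    then have i1: "i = 1"
      using nth_weight_inj[OF v i(2), of 1] first_weight_1[OF e(1)] e(2) by simp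
    have "a = {#Vert v#}" "b = kept_side G w v"
      using first_weight_1[OF e(1) \<open>w e = 1\<close>]
      by (simp_all add: a b i1 kept_side_def q_elem_def nth_weight_0)
    then show ?thesis
      using vZ e(1) \<open>w e = 1\<close>
      by (intro bexI[of _ "(Vert v, kept_side G w v)"]) (auto simp: expansion_rules_def)
  qed
qed

lemma Vert_in_reversed_side:
  assumes "e \<in> reversed_arcs G w"
  shows "Vert y \<in># reversed_side G w e \<longleftrightarrow> y = tail G e"
proof -
  let ?v = "tail G e"
  have "?v \<in> verts G" using assms by (auto simp: reversed_arcs_def)
  then have "nth_weight G w ?v (weight_count G w ?v - 1) < w e"
    using nth_weight_strict_mono[of ?v "weight_count G w ?v - 1" "weight_count G w ?v"]
      reversed_arc_last_weight[OF assms] by simp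
  then show ?thesis
    by (auto simp: reversed_side_def Let_def q_elem_def)
qed

lemma Vert_in_kept_side:
  assumes "v \<in> verts G"
  shows "Vert y \<in># kept_side G w v \<longleftrightarrow> (\<exists>e\<in>out_arcs G v. w e = 1 \<and> y = head G e)"
proof -
  have "finite {e. e \<in> out_arcs G v \<and> w e = 1}"
    by (rule finite_subset[OF _ row_finite[OF assms]]) auto
  then show ?thesis
    by (auto simp: kept_side_def q_elem_def set_mset_sum)
qed

text \<open>What accompanies one copy of \<open>s(e)\<close> is either \<open>q\<close> or, if all edges from \<open>s(e)\<close> have the weight
  \<open>w(e) > 1\<close>, another copy of \<open>s(e)\<close>.\<close>

lemma reversed_side_exit:
  assumes "e \<in> arcs G" "1 < w e"
  shows "reversed_side G w e \<noteq> {#Vert (tail G e)#}"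
proof (cases "weight_count G w (tail G e) \<le> 1")
  case True
  then have "reversed_side G w e = replicate_mset (w e) (Vert (tail G e))"
    by (auto simp: reversed_side_def Let_def q_elem_def nth_weight_0)
  then have "size (reversed_side G w e) = w e" by simp
  with assms(2) show ?thesis by auto
next
  case False
  then have "Q (tail G e) (weight_count G w (tail G e) - 1) \<in># reversed_side G w e"
    by (simp add: reversed_side_def Let_def q_elem_def)
  then show ?thesis by auto
qed

sublocale oriented_presentation "monoid_gens G w" "monoid_rels G w" "expansion_rules G w"
proof
  show "monoid_rels G w \<subseteq> free_cm (monoid_gens G w) \<times> free_cm (monoid_gens G w)"
    by (rule monoid_rels_subset)
  show "({#x#}, m) \<in> monoid_rels G w \<union> (monoid_rels G w)\<inverse>" if "(x, m) \<in> expansion_rules G w" for x m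
    using that reversed_side_rel kept_side_rel by (auto simp: expansion_rules_def)
  show "\<exists>(x, m)\<in>expansion_rules G w. (a, b) = ({#x#}, m) \<or> (a, b) = (m, {#x#})"
    if "(a, b) \<in> monoid_rels G w" for a b
    using that by (rule rel_is_expansion_rule)
  show "m \<noteq> {#}" if rule: "(x, m) \<in> expansion_rules G w" for x m
  proof -
    from rule have "\<exists>y. Vert y \<in># m"
      by (auto simp: expansion_rules_def Vert_in_reversed_side Vert_in_kept_side)
         (metis in_out_arcs_conv)
    then show ?thesis by auto
  qed
qed


section \<open>Arrows between vertices and the auxiliary graph\<close>

abbreviation "H \<equiv> aux_graph (p1_graph G w) (p1_weight w)"

definition plain_steps :: "('v \<times> 'v) set" where
  "plain_steps = {(tail G e, head G e) | e. e \<in> arcs G \<and> tail G e \<notin> Z \<and> w e = 1} \<union>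
     {(head G e, tail G e) | e. e \<in> arcs G \<and> tail G e \<in> Z}"

definition bar_steps :: "('v \<times> 'v) set" where
  "bar_steps = {(head G e, tail G e) | e. e \<in> arcs G \<and> tail G e \<notin> Z \<and> 1 < w e}"

lemma wf_H: "wf_digraph H"
  by (intro wf_digraph.wf_aux_graph wf_p1_graph)

lemma bar_arc_iff:
  "Bar g \<in> arcs H \<longleftrightarrow> (\<exists>e\<in>arcs G. g = Kept e \<and> tail G e \<notin> Z \<and> 1 < w e)"
  by (auto simp: aux_graph_def weighted_arcs_def p1_graph_def)

lemma bar_arc_ends: "tail H (Bar (Kept e)) = head G e" "head H (Bar (Kept e)) = tail G e"
  by (auto simp: aux_graph_def p1_graph_def)

lemma arcs_ends_H: "arcs_ends H = plain_steps \<union> bar_steps"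
proof (intro subset_antisym subsetI)
  fix p assume "p \<in> arcs_ends H"
  then show "p \<in> plain_steps \<union> bar_steps"
    by (auto simp: arcs_ends_conv aux_graph_def p1_graph_def unweighted_arcs_def weighted_arcs_def
        plain_steps_def bar_steps_def)
next
  fix p assume "p \<in> plain_steps \<union> bar_steps"
  then consider e where "p = (tail G e, head G e)" "e \<in> arcs G" "tail G e \<notin> Z" "w e = 1"
    | e where "p = (head G e, tail G e)" "e \<in> arcs G" "tail G e \<in> Z"
    | e where "p = (head G e, tail G e)" "e \<in> arcs G" "tail G e \<notin> Z" "1 < w e"
    by (auto simp: plain_steps_def bar_steps_def)
  then show "p \<in> arcs_ends H"
  proof cases
    case 1
    then show ?thesis
      unfolding arcs_ends_conv
      by (intro image_eqI[of _ _ "Plain (Kept e)"])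
         (auto simp: aux_graph_def p1_graph_def unweighted_arcs_def)
  next
    case 2
    then show ?thesis
      unfolding arcs_ends_conv
      using weight_pos[of e] by (intro image_eqI[of _ _ "Plain (Rev e 1)"])
         (auto simp: aux_graph_def p1_graph_def unweighted_arcs_def)
  next
    case 3
    then show ?thesis
      unfolding arcs_ends_conv
      by (intro image_eqI[of _ _ "Bar (Kept e)"]) (simp_all add: bar_arc_ends bar_arc_iff)
  qed
qed

text \<open>An arc lies on a cycle iff its source is reachable from its target, so bar cycles can be
  recognised from the step relation without reference to arc lists.\<close>

lemma bar_cycle_iff:
  "(\<exists>p. pre_digraph.cycle H p \<and> (\<exists>g. Bar g \<in> set p)) \<longleftrightarrow>
     (\<exists>(a, b)\<in>bar_steps. (b, a) \<in> (arcs_ends H)\<^sup>*)"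
proof -
  interpret H: wf_digraph H by (rule wf_H)
  have "(\<exists>p. pre_digraph.cycle H p \<and> (\<exists>g. Bar g \<in> set p)) \<longleftrightarrow>
      (\<exists>g. Bar g \<in> arcs H \<and> head H (Bar g) \<rightarrow>\<^sup>*\<^bsub>H\<^esub> tail H (Bar g))"
    using H.cycle_through_arc H.cycle_arc_reachable by metis
  also have "\<dots> \<longleftrightarrow> (\<exists>e\<in>arcs G. tail G e \<notin> Z \<and> 1 < w e \<and> (tail G e, head G e) \<in> (arcs_ends H)\<^sup>*)"
  proof -
    have "verts H = verts G" by (simp add: aux_graph_def p1_graph_def)
    then have "tail G e \<rightarrow>\<^sup>*\<^bsub>H\<^esub> head G e \<longleftrightarrow> (tail G e, head G e) \<in> (arcs_ends H)\<^sup>*"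
      if "e \<in> arcs G" for e
      using that by (simp add: H.reachable_conv')
    then show ?thesis by (auto simp: bar_arc_iff bar_arc_ends)
  qed
  also have "\<dots> \<longleftrightarrow> (\<exists>(a, b)\<in>bar_steps. (b, a) \<in> (arcs_ends H)\<^sup>*)"
    by (auto simp: bar_steps_def)
  finally show ?thesis .
qed

text \<open>Steps from \<open>Z\<close> run backwards along edges inside \<open>Z\<close> and stay in \<open>Z\<close>; the other steps run forwards
  along edges. A closed walk thus lies on one side and traverses a closed walk of the graph in one
  direction.\<close>

lemma acyclic_plain_steps: "acyclic plain_steps"
proof -
  have "if x \<in> Z then y \<in> Z \<and> y \<rightarrow>\<^sup>+ x else y \<notin> Z \<longrightarrow> x \<rightarrow>\<^sup>+ y" if "(x, y) \<in> plain_steps\<^sup>+" for x y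
    using that
  proof induction
    case (base y)
    then show ?case
      using head_reversed by (auto simp: plain_steps_def reversed_arcs_def arcs_ends_conv)
  next
    case (step y z)
    from step.hyps(2) have yz: "y \<in> Z \<and> z \<in> Z \<and> z \<rightarrow> y \<or> y \<notin> Z \<and> y \<rightarrow> z"
      using head_reversed by (auto simp: plain_steps_def reversed_arcs_def arcs_ends_conv)
    then show ?case
      using step.IH by (auto intro: trancl_into_trancl trancl_into_trancl2 split: if_splits)
  qed
  then show ?thesis
    using acyclic_arcs_ends[OF acyclic] unfolding acyclic_def by metis
qed

lemma arrows_Vert_iff: "(Vert x, Vert y) \<in> arrows (expansion_rules G w) \<longleftrightarrow> (x, y) \<in> arcs_ends H"
proof -
  have "(Vert x, Vert y) \<in> arrows (expansion_rules G w) \<longleftrightarrow>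
      (\<exists>e\<in>reversed_arcs G w. x = head G e \<and> Vert y \<in># reversed_side G w e) \<or>
      x \<notin> Z \<and> (\<exists>e\<in>out_arcs G x. w e = 1) \<and> Vert y \<in># kept_side G w x"
    unfolding arrows_def expansion_rules_def by blast
  also have "\<dots> \<longleftrightarrow> (\<exists>e\<in>reversed_arcs G w. x = head G e \<and> y = tail G e) \<or>
      x \<notin> Z \<and> (\<exists>e\<in>out_arcs G x. w e = 1 \<and> y = head G e)"
  proof -
    have "(\<exists>e\<in>out_arcs G x. w e = 1) \<and> Vert y \<in># kept_side G w x \<longleftrightarrow>
        (\<exists>e\<in>out_arcs G x. w e = 1 \<and> y = head G e)"
    proof (cases "x \<in> verts G")
      case True
      then show ?thesis unfolding Vert_in_kept_side[OF True] by blast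
    next
      case False
      then have "out_arcs G x = {}" by auto
      then show ?thesis by simp
    qed
    then show ?thesis by (simp add: Vert_in_reversed_side cong: bex_cong)
  qed
  also have "\<dots> \<longleftrightarrow> (x, y) \<in> plain_steps \<union> bar_steps"
  proof -
    have "(\<exists>e\<in>reversed_arcs G w. x = head G e \<and> y = tail G e) \<longleftrightarrow>
        (\<exists>e\<in>arcs G. tail G e \<in> Z \<and> x = head G e \<and> y = tail G e) \<or> (x, y) \<in> bar_steps"
      unfolding reversed_arcs_def bar_steps_def by blast
    moreover have "x \<notin> Z \<and> (\<exists>e\<in>out_arcs G x. w e = 1 \<and> y = head G e) \<longleftrightarrow>
        (\<exists>e\<in>arcs G. tail G e \<notin> Z \<and> w e = 1 \<and> x = tail G e \<and> y = head G e)"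
      unfolding out_arcs_def by blast
    ultimately show ?thesis
      unfolding plain_steps_def by blast
  qed
  finally show ?thesis unfolding arcs_ends_H .
qed

lemma arrows_rtrancl_Vert:
  "(x, y) \<in> (arcs_ends H)\<^sup>* \<Longrightarrow> (Vert x, Vert y) \<in> (arrows (expansion_rules G w))\<^sup>*"
  by (induction rule: rtrancl_induct) (auto simp flip: arrows_Vert_iff intro: rtrancl_into_rtrancl)

lemma arrow_source_Vert: "(x, y) \<in> arrows (expansion_rules G w) \<Longrightarrow> \<exists>u. x = Vert u"
  by (auto simp: arrows_def expansion_rules_def)

lemma arrows_trancl_Vert:
  assumes "(x, y) \<in> (arrows (expansion_rules G w))\<^sup>+" "y = Vert v"
  shows "\<exists>u. x = Vert u \<and> (u, v) \<in> (arcs_ends H)\<^sup>+"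
  using assms
proof (induction arbitrary: v)
  case (base y)
  obtain u where "x = Vert u" using arrow_source_Vert[OF base.hyps] by blast
  with base show ?case by (auto simp: arrows_Vert_iff)
next
  case (step y z)
  obtain u' where u': "y = Vert u'" using arrow_source_Vert[OF step.hyps(2)] by blast
  with step.hyps(2) step.prems have "(u', v) \<in> arcs_ends H" by (simp add: arrows_Vert_iff)
  with step.IH[OF u'] show ?case by (auto intro: trancl_into_trancl)
qed

lemma acyclic_arrows:
  assumes "acyclic (arcs_ends H)"
  shows "acyclic (arrows (expansion_rules G w))"
  unfolding acyclic_def
proof (intro allI notI)
  fix x assume x: "(x, x) \<in> (arrows (expansion_rules G w))\<^sup>+"
  then obtain u where "x = Vert u" using arrow_source_Vert by (meson tranclD)
  with x arrows_trancl_Vert[of x x u] assms show False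
    by (auto simp: acyclic_def)
qed

lemma cancellative_iff_no_bar_cycle:
  "comm_monoid_cancel (weighted_graph_monoid G w) \<longleftrightarrow>
     \<not> (\<exists>p. pre_digraph.cycle H p \<and> (\<exists>g. Bar g \<in> set p))"
  unfolding bar_cycle_iff weighted_graph_monoid_def
proof
  assume "\<not> (\<exists>(a, b)\<in>bar_steps. (b, a) \<in> (arcs_ends H)\<^sup>*)"
  then have "acyclic (arcs_ends H)"
    unfolding arcs_ends_H using acyclic_plain_steps by (intro acyclic_Un_if_no_back_path) auto
  then show "comm_monoid_cancel (presented_monoid (monoid_gens G w) (monoid_rels G w))"
    by (intro cancel_if_acyclic single_valued_expansion_rules acyclic_arrows)
next
  assume cancel: "comm_monoid_cancel (presented_monoid (monoid_gens G w) (monoid_rels G w))"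
  show "\<not> (\<exists>(a, b)\<in>bar_steps. (b, a) \<in> (arcs_ends H)\<^sup>*)"
  proof
    assume "\<exists>(a, b)\<in>bar_steps. (b, a) \<in> (arcs_ends H)\<^sup>*"
    then obtain e where e: "e \<in> arcs G" "1 < w e" "(tail G e, head G e) \<in> (arcs_ends H)\<^sup>*"
      by (auto simp: bar_steps_def)
    then have rev: "e \<in> reversed_arcs G w" by (simp add: reversed_arcs_def)
    then have "(Vert (head G e), reversed_side G w e) \<in> expansion_rules G w"
      by (auto simp: expansion_rules_def)
    then show False
      using cancel not_cancel_if_cycle_with_exit Vert_in_reversed_side[OF rev]
        reversed_side_exit[OF e(1,2)] arrows_rtrancl_Vert[OF e(3)] by blast
  qed
qed

end

theorem corollary4p17:
  fixes G :: "('v, 'e) pre_digraph" and w :: "'e \<Rightarrow> nat"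
  assumes "lpa_weighted_graph G w"
    and "acyclic_digraph G"
  shows "comm_monoid_cancel (weighted_graph_monoid G w) \<longleftrightarrow>
    \<not> (\<exists>p. pre_digraph.cycle (aux_graph (p1_graph G w) (p1_weight w)) p \<and> (\<exists>g. Bar g \<in> set p))"
proof -
  interpret acyclic_lpa_graph G w
    using assms by (simp add: acyclic_lpa_graph_def acyclic_lpa_graph_axioms_def)
  show ?thesis by (rule cancellative_iff_no_bar_cycle)
qed

end
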